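(* Let $\gamma,\delta>0$ with $\gamma\delta\|\mathbf{A}\mathbf{A}^\top\|\le1$, and let $\mathbf{T}$ be the operator (defined in the context) given by the PD3O iteration with $f=0$ and $l^*=0$, which is the Chambolle–Pock iteration written in the variables $(\mathbf{z},\mathbf{s})$. For any $(\mathbf{z}_1,\mathbf{s}_1),(\mathbf{z}_2,\mathbf{s}_2)\in\mathcal{X}\times\mathcal{S}$ and $(\mathbf{z}_i^+,\mathbf{s}_i^+)=\mathbf{T}(\mathbf{z}_i,\mathbf{s}_i)$, $i=1,2$, $$\|\mathbf{z}_1^+-\mathbf{z}_2^+\|^2+\|\mathbf{s}_1^+-\mathbf{s}_2^+\|_{\mathbf{M}}^2-\|\mathbf{z}_1-\mathbf{z}_2\|^2-\|\mathbf{s}_1-\mathbf{s}_2\|_{\mathbf{M}}^2\le-\|\mathbf{z}_1^+-\mathbf{z}_1-\mathbf{z}_2^++\mathbf{z}_2\|^2-\|\mathbf{s}_1^+-\mathbf{s}_1-\mathbf{s}_2^++\mathbf{s}_2\|_{\mathbf{M}}^2.$$ That is, when $\mathbf{M}$ is positive definite, the Chambolle–Pock iteration, written as the operator $\mathbf{T}$ in the variables $(\mathbf{z},\mathbf{s})$, is firmly nonexpansive under the norm $\|(\cdot,\cdot)\|_{\mathbf{I},\mathbf{M}}$.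
   Context: $\mathcal{X}$ and $\mathcal{S}$ are real Hilbert spaces, $\mathbf{A}:\mathcal{X}\to\mathcal{S}$ is a bounded linear operator with adjoint $\mathbf{A}^\top$, $\mathbf{I}$ is the identity operator; $g:\mathcal{X}\to(-\infty,+\infty]$ and $h:\mathcal{S}\to(-\infty,+\infty]$ are proper lower semi-continuous convex functions and $h^*$ is the convex conjugate of $h$. For $\lambda>0$ and a proper lower semi-continuous convex function $\phi$, $\mathbf{prox}_{\lambda\phi}(\tilde{\mathbf{x}})=\arg\min_{\mathbf{x}}\lambda\phi(\mathbf{x})+\frac12\|\mathbf{x}-\tilde{\mathbf{x}}\|^2$. The operator $\mathbf{T}:(\mathbf{z},\mathbf{s})\mapsto(\mathbf{z}^+,\mathbf{s}^+)$ on $\mathcal{X}\times\mathcal{S}$ is $$\mathbf{x}=\mathbf{prox}_{\gamma g}(\mathbf{z}),\quad \mathbf{s}^+=\mathbf{prox}_{\delta h^*}\big((\mathbf{I}-\gamma\delta\mathbf{A}\mathbf{A}^\top)\mathbf{s}+\delta\mathbf{A}(2\mathbf{x}-\mathbf{z})\big),\quad \mathbf{z}^+=\mathbf{x}-\gamma\mathbf{A}^\top\mathbf{s}^+.$$ With $\bar{\mathbf{x}}=2\mathbf{x}-\mathbf{z}-\gamma\mathbf{A}^\top\mathbf{s}$ this is the Chambolle–Pock iteration $\mathbf{s}^+=\mathbf{prox}_{\delta h^*}(\mathbf{s}+\delta\mathbf{A}\bar{\mathbf{x}})$, $\mathbf{x}^+=\mathbf{prox}_{\gamma g}(\mathbf{x}-\gamma\mathbf{A}^\top\mathbf{s}^+)$,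 $\bar{\mathbf{x}}^+=2\mathbf{x}^+-\mathbf{x}$. $\mathbf{M}=\frac{\gamma}{\delta}(\mathbf{I}-\gamma\delta\mathbf{A}\mathbf{A}^\top)$ (positive semidefinite since $\gamma\delta\|\mathbf{A}\mathbf{A}^\top\|\le1$), $\|\mathbf{s}\|_{\mathbf{M}}=\sqrt{\langle\mathbf{s},\mathbf{M}\mathbf{s}\rangle}$, $\|(\mathbf{z},\mathbf{s})\|_{\mathbf{I},\mathbf{M}}=\sqrt{\|\mathbf{z}\|^2+\|\mathbf{s}\|_{\mathbf{M}}^2}$. An operator $\mathbf{T}$ is firmly nonexpansive under a norm $\|\cdot\|$ if $\|\mathbf{T}u_1-\mathbf{T}u_2\|^2\le\|u_1-u_2\|^2-\|(\mathbf{I}-\mathbf{T})u_1-(\mathbf{I}-\mathbf{T})u_2\|^2$ for all $u_1,u_2$. *)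

theory Defs
  imports "HOL-Analysis.Analysis"
begin

text \<open>
  Real Hilbert spaces are types of sort \<open>{real_inner, complete_space}\<close>. Functions with values in
  \<open>(-\<infinity>, +\<infinity>]\<close> are functions into \<^typ>\<open>ereal\<close> that never take the value \<open>-\<infinity>\<close>; this is part of
  \<open>proper_fun\<close>. On \<^typ>\<open>ereal\<close> we have \<open>0 * \<infinity> = 0\<close>, so the end points of the segment are
  harmless in \<open>convex_fun\<close>.
\<close>

definition proper_fun :: "('a \<Rightarrow> ereal) \<Rightarrow> bool" where
  "proper_fun f \<longleftrightarrow> (\<forall>x. f x \<noteq> -\<infinity>) \<and> (\<exists>x. f x \<noteq> \<infinity>)"

definition lsc_fun :: "('a::topological_space \<Rightarrow> ereal) \<Rightarrow> bool" where
  "lsc_fun f \<longleftrightarrow> (\<forall>x. f x \<le> Liminf (at x) f)"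

definition convex_fun :: "('a::real_vector \<Rightarrow> ereal) \<Rightarrow> bool" where
  "convex_fun f \<longleftrightarrow> (\<forall>x y. \<forall>u\<ge>0. \<forall>v\<ge>0. u + v = 1 \<longrightarrow>
      f (u *\<^sub>R x + v *\<^sub>R y) \<le> ereal u * f x + ereal v * f y)"

definition convex_conjugate :: "('a::real_inner \<Rightarrow> ereal) \<Rightarrow> 'a \<Rightarrow> ereal" where
  "convex_conjugate h y = (SUP x. ereal (x \<bullet> y) - h x)"

definition prox :: "real \<Rightarrow> ('a::real_inner \<Rightarrow> ereal) \<Rightarrow> 'a \<Rightarrow> 'a" where
  "prox c \<phi> w = (ARG_MIN (\<lambda>x. ereal c * \<phi> x + ereal (1/2 * (norm (x - w))\<^sup>2)) x. True)"

text \<open>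
  The operator \<open>T\<close> in the variables \<open>(z, s)\<close>, and one step of the Chambolle--Pock iteration in the
  variables \<open>(x, xbar, s)\<close>; \<open>cp_vars\<close> is the change of variables from the former to the latter.
\<close>

definition cp_operator ::
  "('x::real_inner \<Rightarrow> ereal) \<Rightarrow> ('s::real_inner \<Rightarrow> ereal) \<Rightarrow> ('x \<Rightarrow> 's) \<Rightarrow> real \<Rightarrow> real
    \<Rightarrow> 'x \<times> 's \<Rightarrow> 'x \<times> 's" where
  "cp_operator g h A \<gamma> \<delta> = (\<lambda>(z, s).
     let x = prox \<gamma> g z;
         s' = prox \<delta> (convex_conjugate h)
                ((s - (\<gamma> * \<delta>) *\<^sub>R A (adjoint A s)) + \<delta> *\<^sub>R A (2 *\<^sub>R x - z))
     in (x - \<gamma> *\<^sub>R adjoint A s', s'))"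

definition chambolle_pock_step ::
  "('x::real_inner \<Rightarrow> ereal) \<Rightarrow> ('s::real_inner \<Rightarrow> ereal) \<Rightarrow> ('x \<Rightarrow> 's) \<Rightarrow> real \<Rightarrow> real
    \<Rightarrow> 'x \<times> 'x \<times> 's \<Rightarrow> 'x \<times> 'x \<times> 's" where
  "chambolle_pock_step g h A \<gamma> \<delta> = (\<lambda>(x, xbar, s).
     let s' = prox \<delta> (convex_conjugate h) (s + \<delta> *\<^sub>R A xbar);
         x' = prox \<gamma> g (x - \<gamma> *\<^sub>R adjoint A s')
     in (x', 2 *\<^sub>R x' - x, s'))"

definition cp_vars ::
  "('x::real_inner \<Rightarrow> ereal) \<Rightarrow> ('x \<Rightarrow> 's::real_inner) \<Rightarrow> real \<Rightarrow> 'x \<times> 's \<Rightarrow> 'x \<times> 'x \<times> 's" where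
  "cp_vars g A \<gamma> = (\<lambda>(z, s).
     let x = prox \<gamma> g z in (x, 2 *\<^sub>R x - z - \<gamma> *\<^sub>R adjoint A s, s))"

definition M_op :: "('x::real_inner \<Rightarrow> 's::real_inner) \<Rightarrow> real \<Rightarrow> real \<Rightarrow> 's \<Rightarrow> 's" where
  "M_op A \<gamma> \<delta> s = (\<gamma> / \<delta>) *\<^sub>R (s - (\<gamma> * \<delta>) *\<^sub>R A (adjoint A s))"

definition positive_definite_op :: "('s::real_inner \<Rightarrow> 's) \<Rightarrow> bool" where
  "positive_definite_op M \<longleftrightarrow> (\<forall>s. s \<noteq> 0 \<longrightarrow> s \<bullet> M s > 0)"

definition weighted_norm :: "('s::real_inner \<Rightarrow> 's) \<Rightarrow> 's \<Rightarrow> real" where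
  "weighted_norm M s = sqrt (s \<bullet> M s)"

definition norm_I_M :: "('s::real_inner \<Rightarrow> 's) \<Rightarrow> 'x::real_inner \<times> 's \<Rightarrow> real" where
  "norm_I_M M = (\<lambda>(z, s). sqrt ((norm z)\<^sup>2 + (weighted_norm M s)\<^sup>2))"

definition firmly_nonexpansive :: "('a::real_vector \<Rightarrow> real) \<Rightarrow> ('a \<Rightarrow> 'a) \<Rightarrow> bool" where
  "firmly_nonexpansive N T \<longleftrightarrow> (\<forall>u\<^sub>1 u\<^sub>2.
     (N (T u\<^sub>1 - T u\<^sub>2))\<^sup>2 \<le> (N (u\<^sub>1 - u\<^sub>2))\<^sup>2 - (N ((u\<^sub>1 - T u\<^sub>1) - (u\<^sub>2 - T u\<^sub>2)))\<^sup>2)"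

end

theory Submission
  imports Defs
begin

text \<open>
  Write \<open>\<Delta>\<close> for the difference of the two runs. Since \<open>M\<close> is symmetric and positive semidefinite,
  \<open>\<parallel>a\<parallel>\<^sup>2 - \<parallel>b\<parallel>\<^sup>2 + \<parallel>a - b\<parallel>\<^sup>2 = 2\<langle>a, a - b\<rangle>\<close> holds in both seminorms, so the claim says
  \<open>\<langle>\<Delta>z', \<Delta>z - \<Delta>z'\<rangle> + \<langle>\<Delta>s', M(\<Delta>s - \<Delta>s')\<rangle> \<ge> 0\<close>. Substituting \<open>z' = x - \<gamma>A\<^sup>\<top>s'\<close>, this sum is exactly
  \<open>\<langle>\<Delta>x, \<Delta>z - \<Delta>x\<rangle> + (\<gamma>/\<delta>)\<langle>\<Delta>s', \<Delta>w - \<Delta>s'\<rangle>\<close>, where \<open>w\<close> is the argument of the second proximal map: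
  all terms in \<open>A\<^sup>\<top>\<Delta>s'\<close> cancel. Both summands are nonnegative because \<open>prox\<close> is firmly nonexpansive
  (\<open>prox_firmly_nonexpansive\<close>). That \<open>T\<close> is the Chambolle--Pock step in other variables is linearity
  of \<open>A\<close>: both iterations evaluate the proximal maps at the same points.

  The analytic work is to show that \<open>prox\<close> and \<open>adjoint\<close>, which are defined by choice, denote what
  they should. A proper lower semicontinuous convex function decreases at most linearly
  (\<open>convex_lsc_linear_minorant\<close>), so its proximal objective is bounded below; by the parallelogram
  law minimizing sequences are Cauchy, and the limit is a minimizer (\<open>prox_objective_attained\<close>). The
  first-order condition at this minimizer (\<open>prox_variational\<close>) is then used in three ways: it gives
  firm nonexpansiveness; it provides an affine minorant of \<open>h\<close>, so that \<open>h\<^sup>*\<close> is proper; and, applied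
  to the negative of a bounded linear functional, it is the Riesz representation theorem, whence the
  adjoint of \<open>A\<close> exists.
\<close>

section \<open>Proper lower semicontinuous convex functions\<close>

text \<open>
  Convexity is used through real upper bounds of the values, that is, on the epigraph, which
  keeps the later estimates inside the real numbers.
\<close>

lemma convex_fun_epigraph:
  assumes "convex_fun f" and "0 \<le> u" and "0 \<le> v" and "u + v = 1"
    and "f x \<le> ereal r" and "f y \<le> ereal s"
  shows "f (u *\<^sub>R x + v *\<^sub>R y) \<le> ereal (u * r + v * s)"
proof -
  have "f (u *\<^sub>R x + v *\<^sub>R y) \<le> ereal u * f x + ereal v * f y"
    using assms unfolding convex_fun_def by blast
  also have "\<dots> \<le> ereal u * ereal r + ereal v * ereal s"
    using assms by (intro add_mono ereal_mult_left_mono) auto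
  finally show ?thesis by simp
qed

lemma proper_fun_obtain_finite:
  assumes "proper_fun f"
  obtains x r where "f x = ereal r"
  using assms unfolding proper_fun_def by (metis ereal_cases)

lemma lsc_fun_iff_eventually:
  "lsc_fun f \<longleftrightarrow> (\<forall>x. \<forall>a<f x. eventually (\<lambda>y. a < f y) (nhds x))"
  unfolding lsc_fun_def le_Liminf_iff eventually_nhds_conv_at by auto

text \<open>
  Lower semicontinuity bounds \<open>f\<close> below near a point \<open>x\<^sub>0\<close> of its domain; a value further away that
  is too small would, by convexity along the segment to \<open>x\<^sub>0\<close>, violate the bound near \<open>x\<^sub>0\<close>.
\<close>

lemma convex_lsc_linear_minorant:
  fixes f :: "'a::real_normed_vector \<Rightarrow> ereal"
  assumes "proper_fun f" and "lsc_fun f" and "convex_fun f"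
  shows "\<exists>K a x\<^sub>0. 0 \<le> K \<and> (\<forall>x r. f x \<le> ereal r \<longrightarrow> a - K * norm (x - x\<^sub>0) \<le> r)"
proof -
  obtain x\<^sub>0 r\<^sub>0 where fx0: "f x\<^sub>0 = ereal r\<^sub>0"
    using proper_fun_obtain_finite[OF assms(1)] .
  have "eventually (\<lambda>y. ereal (r\<^sub>0 - 1) < f y) (nhds x\<^sub>0)"
    using assms(2) fx0 unfolding lsc_fun_iff_eventually by auto
  then obtain d where d: "d > 0" "\<And>y. dist y x\<^sub>0 < d \<Longrightarrow> ereal (r\<^sub>0 - 1) < f y"
    unfolding eventually_nhds_metric by blast
  define e where "e = d / 2"
  have e: "e > 0" "e < d" using d by (auto simp: e_def)
  have "\<forall>x r. f x \<le> ereal r \<longrightarrow> (r\<^sub>0 - 1) - 1 / e * norm (x - x\<^sub>0) \<le> r"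
  proof (intro allI impI)
    fix x r assume fx: "f x \<le> ereal r"
    show "(r\<^sub>0 - 1) - 1 / e * norm (x - x\<^sub>0) \<le> r"
    proof (cases "norm (x - x\<^sub>0) < d")
      case True
      then have "ereal (r\<^sub>0 - 1) < f x" using d(2)[of x] by (simp add: dist_norm)
      with fx have "r\<^sub>0 - 1 < r" by (metis less_le_trans ereal_less(2) less_ereal.simps(1))
      moreover have "0 \<le> 1 / e * norm (x - x\<^sub>0)" using e by simp
      ultimately show ?thesis by linarith
    next
      case False
      define t where "t = e / norm (x - x\<^sub>0)"
      have n: "norm (x - x\<^sub>0) > 0" using False d by linarith
      have t: "0 < t" "t < 1" using e n False by (auto simp: t_def field_simps)
      define y where "y = t *\<^sub>R x + (1 - t) *\<^sub>R x\<^sub>0"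
      have "y - x\<^sub>0 = t *\<^sub>R (x - x\<^sub>0)" by (simp add: y_def algebra_simps)
      then have "norm (y - x\<^sub>0) = e" using t n e by (simp add: t_def)
      then have "ereal (r\<^sub>0 - 1) < f y" using d(2)[of y] e by (simp add: dist_norm)
      also have "f y \<le> ereal (t * r + (1 - t) * r\<^sub>0)"
        unfolding y_def using t fx fx0 by (intro convex_fun_epigraph assms(3)) auto
      finally have "r\<^sub>0 - 1 < t * r + (1 - t) * r\<^sub>0" by simp
      then have "t * (r\<^sub>0 - r) < 1" by (simp add: algebra_simps)
      then have "r\<^sub>0 - r < 1 / e * norm (x - x\<^sub>0)" using e n by (simp add: t_def field_simps)
      then show ?thesis by linarith
    qed
  qed
  moreover have "0 \<le> 1 / e" using e by simp
  ultimately show ?thesis by blast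
qed

section \<open>The proximal map\<close>

text \<open>
  The objective is strongly convex, so by the parallelogram law the distance between two nearly
  optimal points is controlled by their excess over the infimum; hence minimizing sequences are
  Cauchy.
\<close>

lemma prox_objective_attained:
  fixes f :: "'a::{real_inner, complete_space} \<Rightarrow> ereal"
  assumes "proper_fun f" and "lsc_fun f" and "convex_fun f" and c: "c > 0"
  shows "\<exists>p b. f p \<le> ereal b \<and> (\<forall>x r. f x \<le> ereal r \<longrightarrow>
      c * b + 1/2 * (norm (p - w))\<^sup>2 \<le> c * r + 1/2 * (norm (x - w))\<^sup>2)"
proof -
  define S where "S = {(x, r). f x \<le> ereal r}"
  define F where "F = (\<lambda>(x, r). c * r + 1/2 * (norm (x - w))\<^sup>2)"
  define m where "m = Inf (F ` S)"
  obtain x\<^sub>1 r\<^sub>1 where "f x\<^sub>1 = ereal r\<^sub>1"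
    using proper_fun_obtain_finite[OF assms(1)] .
  then have "(x\<^sub>1, r\<^sub>1) \<in> S" by (simp add: S_def)
  then have ne: "F ` S \<noteq> {}" by blast
  obtain K a x\<^sub>0 where K: "0 \<le> K"
    and lin: "\<And>x r. f x \<le> ereal r \<Longrightarrow> a - K * norm (x - x\<^sub>0) \<le> r"
    using convex_lsc_linear_minorant[OF assms(1-3)] by metis
  \<comment> \<open>Completing the square in \<open>norm (x - w)\<close>: the quadratic term beats the linear minorant.\<close>
  have "c * a - c * K * norm (w - x\<^sub>0) - (c * K)\<^sup>2 / 2 \<le> F (x, r)" if "f x \<le> ereal r" for x r
  proof -
    have "c * K * norm (x - x\<^sub>0) \<le> c * K * (norm (x - w) + norm (w - x\<^sub>0))"
      using c K norm_triangle_ineq[of "x - w" "w - x\<^sub>0"] by (intro mult_left_mono) auto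
    moreover have "c * (a - K * norm (x - x\<^sub>0)) \<le> c * r"
      using c lin[OF that] by (intro mult_left_mono) auto
    moreover have "0 \<le> (norm (x - w) - c * K)\<^sup>2" by simp
    ultimately show ?thesis by (simp add: F_def power2_eq_square algebra_simps)
  qed
  then have bdd: "bdd_below (F ` S)"
    by (intro bdd_belowI2) (auto simp: S_def)
  have m_le: "m \<le> F (x, r)" if "f x \<le> ereal r" for x r
    unfolding m_def using bdd that by (intro cInf_lower) (auto simp: S_def)
  have "\<exists>q. q \<in> S \<and> F q < m + 1 / real (Suc n)" for n
    using cInf_lessD[OF ne, of "m + 1 / real (Suc n)"] by (auto simp: m_def)
  then obtain q where q: "\<And>n. q n \<in> S" "\<And>n. F (q n) < m + 1 / real (Suc n)"
    by metis
  define x where "x = (\<lambda>n. fst (q n))"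
  define r where "r = (\<lambda>n. snd (q n))"
  have fx: "f (x n) \<le> ereal (r n)" for n
    using q(1)[of n] by (auto simp: S_def x_def r_def split: prod.splits)
  have Fx: "c * r n + 1/2 * (norm (x n - w))\<^sup>2 < m + 1 / real (Suc n)" for n
    using q(2)[of n] by (simp add: F_def x_def r_def split_beta)
  \<comment> \<open>The midpoint has value at least \<open>m\<close>, and the parallelogram law makes its value smaller than
    the average of the two by a multiple of the squared distance.\<close>
  have gap: "(norm (x i - x j))\<^sup>2 \<le> 4 * (1 / real (Suc i) + 1 / real (Suc j))" for i j
  proof -
    have "f ((1/2) *\<^sub>R x i + (1/2) *\<^sub>R x j) \<le> ereal (1/2 * r i + 1/2 * r j)"
      using fx by (intro convex_fun_epigraph assms(3)) auto
    from m_le[OF this]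
    have "m \<le> c * (1/2 * r i + 1/2 * r j)
        + 1/2 * (norm ((1/2) *\<^sub>R x i + (1/2) *\<^sub>R x j - w))\<^sup>2"
      by (simp add: F_def)
    moreover have "(1/2) *\<^sub>R x i + (1/2) *\<^sub>R x j - w = (1/2) *\<^sub>R ((x i - w) + (x j - w))"
      by (simp add: algebra_simps flip: scaleR_add_left)
    moreover have "(norm ((1/2) *\<^sub>R ((x i - w) + (x j - w))))\<^sup>2
        = 1/2 * (norm (x i - w))\<^sup>2 + 1/2 * (norm (x j - w))\<^sup>2 - 1/4 * (norm (x i - x j))\<^sup>2"
      by (simp add: power2_norm_eq_inner inner_simps inner_commute algebra_simps)
    ultimately show ?thesis using Fx[of i] Fx[of j] by (simp add: algebra_simps)
  qed
  have "Cauchy x"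
  proof (rule metric_CauchyI)
    fix e :: real assume e: "0 < e"
    obtain N where N: "1 / real (Suc N) < e\<^sup>2 / 8"
      using reals_Archimedean[of "e\<^sup>2 / 8"] e by (auto simp: inverse_eq_divide)
    have "dist (x i) (x j) < e" if "N \<le> i" "N \<le> j" for i j
    proof -
      have "1 / real (Suc k) \<le> 1 / real (Suc N)" if "N \<le> k" for k
        using that by (simp add: field_simps)
      then have "4 * (1 / real (Suc i) + 1 / real (Suc j))
          \<le> 4 * (1 / real (Suc N) + 1 / real (Suc N))"
        using that by (intro mult_left_mono add_mono) auto
      also have "\<dots> < e\<^sup>2" using N by (simp add: field_simps)
      finally have "(norm (x i - x j))\<^sup>2 < e\<^sup>2" using gap[of i j] by (rule le_less_trans[rotated])
      then show ?thesis using e by (simp add: dist_norm power2_less_imp_less)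
    qed
    then show "\<exists>N. \<forall>i\<ge>N. \<forall>j\<ge>N. dist (x i) (x j) < e" by blast
  qed
  then obtain p where p: "x \<longlonglongrightarrow> p"
    using Cauchy_convergent_iff convergent_def by blast
  define b where "b = (m - 1/2 * (norm (p - w))\<^sup>2) / c"
  have "(\<lambda>n. (m + 1 / real (Suc n) - 1/2 * (norm (x n - w))\<^sup>2) / c)
      \<longlonglongrightarrow> (m + 0 - 1/2 * (norm (p - w))\<^sup>2) / c"
    using c by (intro tendsto_intros p LIMSEQ_Suc[OF lim_1_over_n]) auto
  then have lim: "(\<lambda>n. (m + 1 / real (Suc n) - 1/2 * (norm (x n - w))\<^sup>2) / c) \<longlonglongrightarrow> b"
    by (simp add: b_def)
  \<comment> \<open>Along the sequence \<open>f\<close> is bounded by numbers tending to \<open>b\<close>, so lower semicontinuity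
    excludes a larger value at the limit.\<close>
  have "f p \<le> ereal b"
  proof (rule ccontr)
    assume "\<not> f p \<le> ereal b"
    then obtain a' where a': "ereal b < ereal a'" "ereal a' < f p"
      using ereal_dense2[of "ereal b" "f p"] by (auto simp: not_le)
    have "eventually (\<lambda>n. ereal a' < f (x n)) sequentially"
      using assms(2) a'(2) p unfolding lsc_fun_iff_eventually filterlim_iff by blast
    moreover have "eventually (\<lambda>n. (m + 1 / real (Suc n) - 1/2 * (norm (x n - w))\<^sup>2) / c < a')
        sequentially"
      using order_tendstoD(2)[OF lim, of a'] a'(1) by simp
    ultimately have "eventually (\<lambda>n. False) sequentially"
    proof eventually_elim
      case (elim n)
      have "a' < r n" using elim(1) fx[of n] by (metis less_le_trans less_ereal.simps(1))
      moreover have "r n \<le> (m + 1 / real (Suc n) - 1/2 * (norm (x n - w))\<^sup>2) / c"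
        using Fx[of n] c by (simp add: pos_le_divide_eq mult.commute)
      ultimately show False using elim(2) by linarith
    qed
    then show False by simp
  qed
  moreover have "c * b + 1/2 * (norm (p - w))\<^sup>2 = m"
    using c by (simp add: b_def)
  moreover have "\<forall>x r. f x \<le> ereal r \<longrightarrow> m \<le> c * r + 1/2 * (norm (x - w))\<^sup>2"
    using m_le by (simp add: F_def)
  ultimately show ?thesis by metis
qed

text \<open>
  This is the optimality condition \<open>w - p \<in> c \<partial>f(p)\<close> for \<open>p = prox c f w\<close>, obtained by comparing
  \<open>p\<close> with points \<open>p + t(x - p)\<close> and letting \<open>t\<close> tend to \<open>0\<close>.
\<close>

lemma prox_variational:
  fixes f :: "'a::{real_inner, complete_space} \<Rightarrow> ereal"
  assumes "proper_fun f" and "lsc_fun f" and "convex_fun f" and c: "c > 0"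
  obtains b where "f (prox c f w) = ereal b"
    and "\<And>x r. f x \<le> ereal r \<Longrightarrow>
      c * b + (w - prox c f w) \<bullet> (x - prox c f w) \<le> c * r"
proof -
  define G where "G = (\<lambda>x. ereal c * f x + ereal (1/2 * (norm (x - w))\<^sup>2))"
  obtain p\<^sub>0 b\<^sub>0 where p0: "f p\<^sub>0 \<le> ereal b\<^sub>0"
    and min0: "\<And>x r. f x \<le> ereal r \<Longrightarrow>
      c * b\<^sub>0 + 1/2 * (norm (p\<^sub>0 - w))\<^sup>2 \<le> c * r + 1/2 * (norm (x - w))\<^sup>2"
    using prox_objective_attained[OF assms, where w = w] by metis
  have G_le: "G x \<le> ereal (c * r + 1/2 * (norm (x - w))\<^sup>2)" if "f x \<le> ereal r" for x r
  proof -
    have "ereal c * f x \<le> ereal c * ereal r" using that c by (intro ereal_mult_left_mono) auto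
    then have "G x \<le> ereal c * ereal r + ereal (1/2 * (norm (x - w))\<^sup>2)"
      unfolding G_def by (intro add_right_mono)
    then show ?thesis by simp
  qed
  have fin: "f x = \<infinity> \<or> (\<exists>r. f x = ereal r)" for x
    using assms(1) unfolding proper_fun_def by (metis ereal_cases)
  have G_inf: "G x = \<infinity>" if "f x = \<infinity>" for x using that c by (simp add: G_def)
  have "is_arg_min G (\<lambda>_. True) p\<^sub>0"
  proof -
    have "\<not> G y < G p\<^sub>0" for y
    proof (cases "f y = \<infinity>")
      case True then show ?thesis using G_inf by simp
    next
      case False
      then obtain r where "f y = ereal r" using fin by blast
      then have "G p\<^sub>0 \<le> G y"
        using order_trans[OF G_le[OF p0]] min0[of y r] by (simp add: G_def)
      then show ?thesis by simp
    qed
    then show ?thesis by (simp add: is_arg_min_def)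
  qed
  define p where "p = prox c f w"
  have pmin: "is_arg_min G (\<lambda>_. True) p"
    unfolding p_def prox_def arg_min_def G_def[symmetric]
    by (rule someI[of "is_arg_min G (\<lambda>_. True)"]) fact
  then have Gp: "G p \<le> G y" for y by (auto simp: is_arg_min_def not_less)
  have "f p \<noteq> \<infinity>" using Gp[of p\<^sub>0] G_le[OF p0] G_inf by force
  then obtain b where b: "f p = ereal b" using fin by blast
  have key: "c * b + (w - p) \<bullet> (x - p) \<le> c * r" if fx: "f x \<le> ereal r" for x r
  proof -
    define D where "D = c * r - c * b - (w - p) \<bullet> (x - p)"
    define E where "E = 1/2 * (norm (x - p))\<^sup>2"
    have le: "- (t * E) \<le> D" if t: "0 < t" "t < 1" for t
    proof -
      define y where "y = t *\<^sub>R x + (1 - t) *\<^sub>R p"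
      have "f y \<le> ereal (t * r + (1 - t) * b)"
        unfolding y_def using t fx b by (intro convex_fun_epigraph assms(3)) auto
      from order_trans[OF Gp G_le[OF this]]
      have "c * b + 1/2 * (norm (p - w))\<^sup>2 \<le> c * (t * r + (1 - t) * b) + 1/2 * (norm (y - w))\<^sup>2"
        by (simp add: G_def b)
      moreover have "y - w = (p - w) + t *\<^sub>R (x - p)" by (simp add: y_def algebra_simps)
      then have "(norm (y - w))\<^sup>2
          = (norm (p - w))\<^sup>2 - 2 * t * ((w - p) \<bullet> (x - p)) + t * t * (norm (x - p))\<^sup>2"
        by (simp only: power2_norm_eq_inner)
          (simp add: inner_simps inner_commute algebra_simps)
      ultimately have "0 \<le> t * (D + t * E)"
        by (simp add: D_def E_def algebra_simps)
      then show ?thesis using t by (simp add: zero_le_mult_iff)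
    qed
    have "((\<lambda>t. - (t * E)) \<longlongrightarrow> - (0 * E)) (at_right 0)"
      by (intro tendsto_intros)
    moreover have "eventually (\<lambda>t. - (t * E) \<le> D) (at_right 0)"
      using le by (auto simp: eventually_at_right_field intro!: exI[of _ 1])
    ultimately have "- (0 * E) \<le> D"
      by (intro tendsto_upperbound[of _ _ "at_right 0"]) auto
    then show ?thesis by (simp add: D_def)
  qed
  show thesis using that b key unfolding p_def by blast
qed

text \<open>Each proximal point is tested in the optimality condition of the other.\<close>

lemma prox_firmly_nonexpansive:
  fixes f :: "'a::{real_inner, complete_space} \<Rightarrow> ereal"
  assumes "proper_fun f" and "lsc_fun f" and "convex_fun f" and "c > 0"
  shows "0 \<le> (prox c f u - prox c f v) \<bullet> ((u - v) - (prox c f u - prox c f v))"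
proof -
  obtain a where a: "f (prox c f u) = ereal a"
    and ua: "\<And>x r. f x \<le> ereal r \<Longrightarrow> c * a + (u - prox c f u) \<bullet> (x - prox c f u) \<le> c * r"
    using prox_variational[OF assms] by blast
  obtain b where b: "f (prox c f v) = ereal b"
    and vb: "\<And>x r. f x \<le> ereal r \<Longrightarrow> c * b + (v - prox c f v) \<bullet> (x - prox c f v) \<le> c * r"
    using prox_variational[OF assms] by blast
  from ua[of "prox c f v" b] vb[of "prox c f u" a] a b
  show ?thesis by (simp add: inner_simps inner_commute)
qed

section \<open>The convex conjugate\<close>

lemma convex_conjugate_le_iff:
  assumes "proper_fun h"
  shows "convex_conjugate h y \<le> ereal t \<longleftrightarrow> (\<forall>x r. h x = ereal r \<longrightarrow> x \<bullet> y - r \<le> t)"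
proof -
  have "ereal (x \<bullet> y) - h x \<le> ereal t \<longleftrightarrow> (\<forall>r. h x = ereal r \<longrightarrow> x \<bullet> y - r \<le> t)" for x
    using assms unfolding proper_fun_def by (cases "h x") auto
  then show ?thesis unfolding convex_conjugate_def SUP_le_iff by simp
qed

lemma convex_conjugate_ge:
  assumes "h x = ereal r"
  shows "ereal (x \<bullet> y - r) \<le> convex_conjugate h y"
  unfolding convex_conjugate_def using assms by (intro SUP_upper2[of x]) auto

text \<open>
  The optimality condition at \<open>prox 1 h 0\<close> is an affine minorant of \<open>h\<close> with slope \<open>- prox 1 h 0\<close>,
  and the conjugate is finite at the slope of any affine minorant.
\<close>

lemma proper_convex_conjugate:
  fixes h :: "'a::{real_inner, complete_space} \<Rightarrow> ereal"
  assumes "proper_fun h" and "lsc_fun h" and "convex_fun h"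
  shows "proper_fun (convex_conjugate h)"
proof -
  define p where "p = prox 1 h 0"
  obtain b where "h p = ereal b"
    and minorant: "\<And>x r. h x \<le> ereal r \<Longrightarrow> b - p \<bullet> (x - p) \<le> r"
    using prox_variational[OF assms zero_less_one, of 0] unfolding p_def
    by (metis add_uminus_conv_diff diff_0 inner_minus_left mult_1)
  have "convex_conjugate h (- p) \<le> ereal (- (p \<bullet> p) - b)"
    unfolding convex_conjugate_le_iff[OF assms(1)]
  proof (intro allI impI)
    fix x r assume "h x = ereal r"
    then show "x \<bullet> - p - r \<le> - (p \<bullet> p) - b"
      using minorant[of x r] by (simp add: inner_simps inner_commute)
  qed
  then have "convex_conjugate h (- p) \<noteq> \<infinity>" by auto
  moreover have "convex_conjugate h y \<noteq> -\<infinity>" for y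
    using convex_conjugate_ge[of h p b y, OF \<open>h p = ereal b\<close>] by auto
  ultimately show ?thesis unfolding proper_fun_def by blast
qed

lemma lsc_convex_conjugate:
  assumes "proper_fun h"
  shows "lsc_fun (convex_conjugate h)"
  unfolding lsc_fun_iff_eventually
proof (intro allI impI)
  fix y a assume "a < convex_conjugate h y"
  then obtain x where x: "a < ereal (x \<bullet> y) - h x"
    unfolding convex_conjugate_def less_SUP_iff by blast
  then obtain r where r: "h x = ereal r"
    using assms unfolding proper_fun_def by (cases "h x") auto
  have "((\<lambda>y'. ereal (x \<bullet> y' - r)) \<longlongrightarrow> ereal (x \<bullet> y - r)) (nhds y)"
    by (intro tendsto_intros filterlim_ident)
  then have "eventually (\<lambda>y'. a < ereal (x \<bullet> y' - r)) (nhds y)"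
    using x r by (intro order_tendstoD) auto
  then show "eventually (\<lambda>y'. a < convex_conjugate h y') (nhds y)"
    by eventually_elim (rule less_le_trans[OF _ convex_conjugate_ge[of h x r, OF r]])
qed

lemma convex_convex_conjugate:
  assumes "proper_fun h"
  shows "convex_fun (convex_conjugate h)"
  unfolding convex_fun_def
proof (intro allI impI)
  fix x y :: 'a and u v :: real
  assume u: "0 \<le> u" and v: "0 \<le> v" and uv: "u + v = 1"
  show "convex_conjugate h (u *\<^sub>R x + v *\<^sub>R y)
      \<le> ereal u * convex_conjugate h x + ereal v * convex_conjugate h y"
    unfolding convex_conjugate_def[of h "u *\<^sub>R x + v *\<^sub>R y"]
  proof (rule SUP_least)
    fix q
    show "ereal (q \<bullet> (u *\<^sub>R x + v *\<^sub>R y)) - h q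
        \<le> ereal u * convex_conjugate h x + ereal v * convex_conjugate h y"
    proof (cases "h q")
      case (real r)
      have "q \<bullet> (u *\<^sub>R x + v *\<^sub>R y) - r = u * (q \<bullet> x - r) + v * (q \<bullet> y - r)"
        using arg_cong[OF uv, of "\<lambda>t. t * r"] by (simp add: inner_simps algebra_simps)
      then have "ereal (q \<bullet> (u *\<^sub>R x + v *\<^sub>R y)) - h q
          = ereal u * ereal (q \<bullet> x - r) + ereal v * ereal (q \<bullet> y - r)"
        by (simp add: real)
      also have "\<dots> \<le> ereal u * convex_conjugate h x + ereal v * convex_conjugate h y"
        using u v convex_conjugate_ge[of h q r, OF real]
        by (intro add_mono ereal_mult_left_mono) auto
      finally show ?thesis .
    qed (use assms in \<open>auto simp: proper_fun_def\<close>)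
  qed
qed

section \<open>Adjoints of bounded operators\<close>

text \<open>
  The representing vector minimizes \<open>\<lambda>x. 1/2 * (norm x)\<^sup>2 - L x\<close>, so it is the proximal point of \<open>-L\<close>
  at \<open>0\<close>; the variational inequality is an equality because \<open>L\<close> is linear.
\<close>

lemma riesz_representation:
  fixes L :: "'a::{real_inner, complete_space} \<Rightarrow> real"
  assumes "bounded_linear L"
  obtains p where "\<And>x. L x = p \<bullet> x"
proof -
  interpret L: bounded_linear L by fact
  define f where "f = (\<lambda>x. ereal (- L x))"
  have "proper_fun f" by (auto simp: proper_fun_def f_def)
  moreover have "lsc_fun f"
    unfolding lsc_fun_iff_eventually
  proof (intro allI impI)
    fix x a assume "a < f x"
    moreover have "(f \<longlongrightarrow> f x) (nhds x)"
      unfolding f_def by (intro tendsto_intros L.tendsto filterlim_ident)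
    ultimately show "eventually (\<lambda>y. a < f y) (nhds x)" by (rule order_tendstoD(1)[rotated])
  qed
  moreover have "convex_fun f"
    by (simp add: convex_fun_def f_def L.add L.scaleR)
  ultimately obtain b where b: "f (prox 1 f 0) = ereal b"
    and var: "\<And>x r. f x \<le> ereal r \<Longrightarrow> 1 * b + (0 - prox 1 f 0) \<bullet> (x - prox 1 f 0) \<le> 1 * r"
    using prox_variational[of f 1 0] by auto
  define p where "p = prox 1 f 0"
  have le: "L y \<le> p \<bullet> y" for y
    using var[of "p + y" "- L (p + y)"] b by (simp add: f_def p_def L.add)
  have "L x = p \<bullet> x" for x using le[of x] le[of "- x"] by (simp add: L.neg)
  then show thesis using that by blast
qed

lemma adjoint_inner:
  fixes A :: "'a::{real_inner, complete_space} \<Rightarrow> 'b::real_inner"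
  assumes "bounded_linear A"
  shows "A x \<bullet> y = x \<bullet> adjoint A y"
proof -
  have "\<exists>p. \<forall>x. A x \<bullet> y = x \<bullet> p" for y
  proof -
    have "bounded_linear (\<lambda>x. A x \<bullet> y)"
      by (rule bounded_linear_compose[OF bounded_linear_inner_left assms])
    from riesz_representation[OF this] show ?thesis by (metis inner_commute)
  qed
  then have "\<exists>f'. \<forall>x y. A x \<bullet> y = x \<bullet> f' y" by metis
  then have "\<forall>x y. A x \<bullet> y = x \<bullet> adjoint A y"
    unfolding adjoint_def by (rule someI_ex)
  then show ?thesis by blast
qed

lemma bounded_linear_adjoint:
  fixes A :: "'a::{real_inner, complete_space} \<Rightarrow> 'b::real_inner"
  assumes A: "bounded_linear A"
  shows "bounded_linear (adjoint A)"
proof -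
  note inner = adjoint_inner[OF A, symmetric]
  have eqI: "u = v" if "\<And>x. x \<bullet> u = x \<bullet> v" for u v :: 'a
    using vector_eq_rdot[of u v] that by (simp add: inner_commute)
  obtain K where K: "\<And>x. norm (A x) \<le> norm x * K" and "0 \<le> K"
    using bounded_linear.nonneg_bounded[OF A] by blast
  show ?thesis
  proof (rule bounded_linear_intro[where K = K])
    show "adjoint A (x + y) = adjoint A x + adjoint A y" for x y
      by (rule eqI) (simp add: inner_add_right inner)
    show "adjoint A (r *\<^sub>R x) = r *\<^sub>R adjoint A x" for r x
      by (rule eqI) (simp add: inner)
    show "norm (adjoint A y) \<le> norm y * K" for y
    proof (cases "norm (adjoint A y) = 0")
      case True
      then show ?thesis using \<open>0 \<le> K\<close> by simp
    next
      case False
      have "norm (adjoint A y) * norm (adjoint A y) = A (adjoint A y) \<bullet> y"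
        by (metis inner power2_norm_eq_inner power2_eq_square)
      also have "\<dots> \<le> norm (A (adjoint A y)) * norm y" by (rule norm_cauchy_schwarz)
      also have "\<dots> \<le> norm (adjoint A y) * K * norm y" using K by (intro mult_right_mono) auto
      finally show ?thesis using False by (simp add: mult.assoc mult.commute)
    qed
  qed
qed

section \<open>The metric and the Chambolle--Pock operator\<close>

lemma M_op_inner:
  fixes A :: "'x::{real_inner, complete_space} \<Rightarrow> 's::real_inner"
  assumes "bounded_linear A"
  shows "s \<bullet> M_op A \<gamma> \<delta> t = (\<gamma> / \<delta>) * (s \<bullet> t - (\<gamma> * \<delta>) * (adjoint A s \<bullet> adjoint A t))"
  using adjoint_inner[OF assms, of "adjoint A t" s]
  by (simp add: M_op_def inner_simps inner_commute)

text \<open>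
  Without semidefiniteness the square of the weighted norm would only be the absolute value of the
  quadratic form.
\<close>

lemma weighted_norm_M_op_squared:
  fixes A :: "'x::{real_inner, complete_space} \<Rightarrow> 's::real_inner"
  assumes A: "bounded_linear A" and pos: "\<gamma> > 0" "\<delta> > 0"
    and small: "\<gamma> * \<delta> * onorm (\<lambda>s. A (adjoint A s)) \<le> 1"
  shows "(weighted_norm (M_op A \<gamma> \<delta>) s)\<^sup>2 = s \<bullet> M_op A \<gamma> \<delta> s"
proof -
  define N where "N = onorm (\<lambda>s. A (adjoint A s))"
  have bl: "bounded_linear (\<lambda>s. A (adjoint A s))"
    by (rule bounded_linear_compose[OF A bounded_linear_adjoint[OF A]])
  have "adjoint A s \<bullet> adjoint A s = A (adjoint A s) \<bullet> s"
    by (rule adjoint_inner[OF A, symmetric])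
  also have "\<dots> \<le> norm (A (adjoint A s)) * norm s" by (rule norm_cauchy_schwarz)
  also have "\<dots> \<le> N * norm s * norm s"
    unfolding N_def using onorm[OF bl] by (intro mult_right_mono) auto
  finally have "\<gamma> * \<delta> * (adjoint A s \<bullet> adjoint A s) \<le> \<gamma> * \<delta> * (N * norm s * norm s)"
    using pos by (intro mult_left_mono) auto
  also have "\<dots> = (\<gamma> * \<delta> * N) * (s \<bullet> s)"
    by (simp add: power2_norm_eq_inner[symmetric] power2_eq_square)
  also have "\<dots> \<le> 1 * (s \<bullet> s)"
    using small by (intro mult_right_mono) (auto simp: N_def)
  finally have "0 \<le> s \<bullet> M_op A \<gamma> \<delta> s"
    unfolding M_op_inner[OF A] using pos by (intro mult_nonneg_nonneg) auto
  then show ?thesis by (simp add: weighted_norm_def)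
qed

lemma chambolle_pock_step_cp_vars:
  fixes A :: "'x::{real_inner, complete_space} \<Rightarrow> 's::{real_inner, complete_space}"
  assumes "bounded_linear A"
  shows "chambolle_pock_step g h A \<gamma> \<delta> (cp_vars g A \<gamma> (z, s))
    = cp_vars g A \<gamma> (cp_operator g h A \<gamma> \<delta> (z, s))"
proof -
  interpret A: bounded_linear A by fact
  have "s + \<delta> *\<^sub>R A (2 *\<^sub>R x - z - \<gamma> *\<^sub>R adjoint A s)
      = (s - (\<gamma> * \<delta>) *\<^sub>R A (adjoint A s)) + \<delta> *\<^sub>R A (2 *\<^sub>R x - z)" for x
    by (simp add: A.add A.diff A.scaleR algebra_simps)
  then show ?thesis
    unfolding chambolle_pock_step_def cp_vars_def cp_operator_def Let_def prod.case
    by (simp only:) simp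
qed

text \<open>
  The left-hand side is the sum of the two firm nonexpansiveness terms of the proximal maps, with
  \<open>x = z' + \<gamma>A\<^sup>\<top>s'\<close>, the second one scaled by \<open>\<gamma>/\<delta>\<close>.
\<close>

lemma cp_cross_terms:
  fixes A :: "'x::{real_inner, complete_space} \<Rightarrow> 's::real_inner"
  assumes A: "bounded_linear A" and "\<delta> > 0"
  defines "B \<equiv> adjoint A"
  shows "x \<bullet> (z - x)
      + (\<gamma> / \<delta>) * (s' \<bullet> ((s - (\<gamma> * \<delta>) *\<^sub>R A (B s)) + \<delta> *\<^sub>R A (2 *\<^sub>R x - z) - s'))
    = (x - \<gamma> *\<^sub>R B s') \<bullet> (z - (x - \<gamma> *\<^sub>R B s')) + s' \<bullet> M_op A \<gamma> \<delta> (s - s')"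
proof -
  interpret B: bounded_linear B unfolding B_def by (rule bounded_linear_adjoint[OF A])
  have sA: "s' \<bullet> A u = B s' \<bullet> u" for u
    using adjoint_inner[OF A, of u s'] by (simp add: B_def inner_commute)
  show ?thesis
    unfolding M_op_inner[OF A] B_def[symmetric] inner_add_right inner_diff_right
      inner_scaleR_right sA B.diff
    using \<open>\<delta> > 0\<close>
    by (simp add: inner_simps inner_commute field_simps power2_eq_square)
qed

theorem corollary1:
  fixes g :: "'x::{real_inner, complete_space} \<Rightarrow> ereal"
    and h :: "'s::{real_inner, complete_space} \<Rightarrow> ereal"
    and A :: "'x \<Rightarrow> 's"
    and \<gamma> \<delta> :: real
  assumes "bounded_linear A"
    and "proper_fun g" and "lsc_fun g" and "convex_fun g"
    and "proper_fun h" and "lsc_fun h" and "convex_fun h"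
    and "\<gamma> > 0" and "\<delta> > 0"
    and "\<gamma> * \<delta> * onorm (\<lambda>s. A (adjoint A s)) \<le> 1"
  shows "let T = cp_operator g h A \<gamma> \<delta>; M = M_op A \<gamma> \<delta> in
    (\<forall>z s. chambolle_pock_step g h A \<gamma> \<delta> (cp_vars g A \<gamma> (z, s)) = cp_vars g A \<gamma> (T (z, s)))
    \<and>
    (\<forall>z\<^sub>1 s\<^sub>1 z\<^sub>2 s\<^sub>2 z\<^sub>1' s\<^sub>1' z\<^sub>2' s\<^sub>2'.
      (z\<^sub>1', s\<^sub>1') = T (z\<^sub>1, s\<^sub>1) \<longrightarrow> (z\<^sub>2', s\<^sub>2') = T (z\<^sub>2, s\<^sub>2) \<longrightarrow>
      (norm (z\<^sub>1' - z\<^sub>2'))\<^sup>2 + (weighted_norm M (s\<^sub>1' - s\<^sub>2'))\<^sup>2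
        - (norm (z\<^sub>1 - z\<^sub>2))\<^sup>2 - (weighted_norm M (s\<^sub>1 - s\<^sub>2))\<^sup>2
      \<le> - (norm (z\<^sub>1' - z\<^sub>1 - z\<^sub>2' + z\<^sub>2))\<^sup>2 - (weighted_norm M (s\<^sub>1' - s\<^sub>1 - s\<^sub>2' + s\<^sub>2))\<^sup>2)
    \<and>
    (positive_definite_op M \<longrightarrow> firmly_nonexpansive (norm_I_M M) T)"
proof -
  note A = assms(1) and g = assms(2-4) and h = assms(5-7) and pos = assms(8,9)
  interpret A: bounded_linear A by (rule A)
  interpret B: bounded_linear "adjoint A" by (rule bounded_linear_adjoint[OF A])
  define T where "T = cp_operator g h A \<gamma> \<delta>"
  define M where "M = M_op A \<gamma> \<delta>"
  have wn: "(weighted_norm M s)\<^sup>2 = s \<bullet> M s" for s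
    unfolding M_def by (rule weighted_norm_M_op_squared[OF A pos assms(10)])
  have M_sym: "s \<bullet> M t = t \<bullet> M s" for s t
    unfolding M_def M_op_inner[OF A] by (simp add: inner_commute)
  have M_diff: "M (s - t) = M s - M t" for s t
    by (simp add: M_def M_op_def A.diff B.diff algebra_simps)
  \<comment> \<open>In both seminorms \<open>\<parallel>a\<parallel>\<^sup>2 - \<parallel>b\<parallel>\<^sup>2 + \<parallel>a - b\<parallel>\<^sup>2 = 2\<langle>a, a - b\<rangle>\<close>.\<close>
  have polar: "(norm a)\<^sup>2 - (norm b)\<^sup>2 + (norm (a - b))\<^sup>2 = - 2 * (a \<bullet> (b - a))" for a b :: 'x
    by (simp add: power2_norm_eq_inner inner_simps inner_commute)
  have M_polar: "(weighted_norm M a)\<^sup>2 - (weighted_norm M b)\<^sup>2 + (weighted_norm M (a - b))\<^sup>2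
      = - 2 * (a \<bullet> M (b - a))" for a b
    unfolding wn M_diff inner_diff_left inner_diff_right using M_sym[of a b] by simp
  have main: "(norm (z\<^sub>1' - z\<^sub>2'))\<^sup>2 + (weighted_norm M (s\<^sub>1' - s\<^sub>2'))\<^sup>2
        - (norm (z\<^sub>1 - z\<^sub>2))\<^sup>2 - (weighted_norm M (s\<^sub>1 - s\<^sub>2))\<^sup>2
      \<le> - (norm (z\<^sub>1' - z\<^sub>1 - z\<^sub>2' + z\<^sub>2))\<^sup>2 - (weighted_norm M (s\<^sub>1' - s\<^sub>1 - s\<^sub>2' + s\<^sub>2))\<^sup>2"
    if T1: "(z\<^sub>1', s\<^sub>1') = T (z\<^sub>1, s\<^sub>1)" and T2: "(z\<^sub>2', s\<^sub>2') = T (z\<^sub>2, s\<^sub>2)"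
    for z\<^sub>1 s\<^sub>1 z\<^sub>2 s\<^sub>2 z\<^sub>1' s\<^sub>1' z\<^sub>2' s\<^sub>2'
  proof -
    define x where "x = prox \<gamma> g"
    define w where "w = (\<lambda>z s. (s - (\<gamma> * \<delta>) *\<^sub>R A (adjoint A s)) + \<delta> *\<^sub>R A (2 *\<^sub>R x z - z))"
    have s': "s\<^sub>1' = prox \<delta> (convex_conjugate h) (w z\<^sub>1 s\<^sub>1)"
        "s\<^sub>2' = prox \<delta> (convex_conjugate h) (w z\<^sub>2 s\<^sub>2)"
      and z': "z\<^sub>1' = x z\<^sub>1 - \<gamma> *\<^sub>R adjoint A s\<^sub>1'" "z\<^sub>2' = x z\<^sub>2 - \<gamma> *\<^sub>R adjoint A s\<^sub>2'"
      using T1 T2 by (simp_all add: T_def cp_operator_def Let_def x_def w_def)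
    define dx dz ds dz' ds'
      where "dx = x z\<^sub>1 - x z\<^sub>2" and "dz = z\<^sub>1 - z\<^sub>2" and "ds = s\<^sub>1 - s\<^sub>2"
        and "dz' = z\<^sub>1' - z\<^sub>2'" and "ds' = s\<^sub>1' - s\<^sub>2'"
    note d_defs = dx_def dz_def ds_def dz'_def ds'_def
    have "0 \<le> dx \<bullet> (dz - dx)"
      unfolding d_defs x_def by (rule prox_firmly_nonexpansive[OF g pos(1)])
    moreover have "0 \<le> ds' \<bullet> (w z\<^sub>1 s\<^sub>1 - w z\<^sub>2 s\<^sub>2 - ds')"
      unfolding d_defs s'
      by (intro prox_firmly_nonexpansive proper_convex_conjugate lsc_convex_conjugate
          convex_convex_conjugate h pos)
    moreover have "w z\<^sub>1 s\<^sub>1 - w z\<^sub>2 s\<^sub>2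
        = (ds - (\<gamma> * \<delta>) *\<^sub>R A (adjoint A ds)) + \<delta> *\<^sub>R A (2 *\<^sub>R dx - dz)"
      by (simp add: w_def d_defs A.diff A.add A.scaleR B.diff algebra_simps)
    moreover have "dz' = dx - \<gamma> *\<^sub>R adjoint A ds'"
      by (simp add: d_defs z' B.diff algebra_simps)
    ultimately have nonneg: "0 \<le> dz' \<bullet> (dz - dz') + ds' \<bullet> M (ds - ds')"
      using cp_cross_terms[OF A pos(2), of dx dz \<gamma> ds' ds] pos
      by (metis M_def add_nonneg_nonneg divide_pos_pos less_imp_le mult_nonneg_nonneg)
    have diffs: "z\<^sub>1' - z\<^sub>1 - z\<^sub>2' + z\<^sub>2 = dz' - dz" "s\<^sub>1' - s\<^sub>1 - s\<^sub>2' + s\<^sub>2 = ds' - ds"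
      by (simp_all add: d_defs)
    show ?thesis
      unfolding diffs d_defs[symmetric]
      using nonneg polar[of dz' dz] M_polar[of ds' ds] by linarith
  qed
  have nIM: "(norm_I_M M (z, s))\<^sup>2 = (norm z)\<^sup>2 + (weighted_norm M s)\<^sup>2" for z :: 'x and s
    by (simp add: norm_I_M_def)
  have M_even: "weighted_norm M (- s) = weighted_norm M s" for s
    using M_diff[of 0 s] M_diff[of 0 0] by (simp add: weighted_norm_def)
  have "firmly_nonexpansive (norm_I_M M) T"
    unfolding firmly_nonexpansive_def
  proof (intro allI)
    fix u\<^sub>1 u\<^sub>2 :: "'x \<times> 's"
    obtain z\<^sub>1 s\<^sub>1 z\<^sub>2 s\<^sub>2 z\<^sub>1' s\<^sub>1' z\<^sub>2' s\<^sub>2' where u: "u\<^sub>1 = (z\<^sub>1, s\<^sub>1)" "u\<^sub>2 = (z\<^sub>2, s\<^sub>2)"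
        and T: "(z\<^sub>1', s\<^sub>1') = T (z\<^sub>1, s\<^sub>1)" "(z\<^sub>2', s\<^sub>2') = T (z\<^sub>2, s\<^sub>2)"
      by (metis surj_pair)
    have "(z\<^sub>1 - z\<^sub>1') - (z\<^sub>2 - z\<^sub>2') = - (z\<^sub>1' - z\<^sub>1 - z\<^sub>2' + z\<^sub>2)"
      and "(s\<^sub>1 - s\<^sub>1') - (s\<^sub>2 - s\<^sub>2') = - (s\<^sub>1' - s\<^sub>1 - s\<^sub>2' + s\<^sub>2)"
      by simp_all
    then have "(norm_I_M M ((u\<^sub>1 - T u\<^sub>1) - (u\<^sub>2 - T u\<^sub>2)))\<^sup>2
        = (norm (z\<^sub>1' - z\<^sub>1 - z\<^sub>2' + z\<^sub>2))\<^sup>2 + (weighted_norm M (s\<^sub>1' - s\<^sub>1 - s\<^sub>2' + s\<^sub>2))\<^sup>2"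
      unfolding u T[symmetric] diff_Pair nIM by (simp only: norm_minus_cancel M_even)
    then show "(norm_I_M M (T u\<^sub>1 - T u\<^sub>2))\<^sup>2
        \<le> (norm_I_M M (u\<^sub>1 - u\<^sub>2))\<^sup>2 - (norm_I_M M ((u\<^sub>1 - T u\<^sub>1) - (u\<^sub>2 - T u\<^sub>2)))\<^sup>2"
      using main[OF T] unfolding u T[symmetric] diff_Pair nIM by simp
  qed
  then show ?thesis
    unfolding Let_def T_def[symmetric] M_def[symmetric]
    using main chambolle_pock_step_cp_vars[OF A, of g h \<gamma> \<delta>, folded T_def] by blast
qed

end
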